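(* Let $K,L\subset\mathbb{R}^n$ be symmetric convex bodies, let $\phi:[0,\infty)\to[0,\infty)$ be a convex increasing function, and let $\mu$ be a log-concave probability measure on $\mathbb{R}^n$ with density $e^{-\phi(\|x\|_L)}$ with respect to Lebesgue measure. Let $r(K,L)=\max\{R>0:RL\subset K\}$. Then $$\limsup_{t\to\infty}\frac{\ln\mu\big((tK)^c\big)}{\phi(r(K,L)\,t)}=-1.$$
   Context: A convex body is a convex compact set with nonempty interior; it is symmetric if $K=-K$. The Minkowski functional of $L$ is $\|x\|_L=\min\{\lambda>0:x\in\lambda L\}$ for $x\neq 0$, with $\|0\|_L=0$. For $t>0$, $tA=\{ta:a\in A\}$, and $A^c=\mathbb{R}^n\setminus A$. "Increasing" is understood as non-decreasing (the function $\phi$ may be constant on an initial interval $[0,t_0]$). *)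

theory Defs
  imports "HOL-Probability.Probability"
begin

definition symmetric_convex_body :: "'a::euclidean_space set \<Rightarrow> bool" where
  "symmetric_convex_body K \<longleftrightarrow>
     convex K \<and> compact K \<and> interior K \<noteq> {} \<and> K = uminus ` K"

definition minkowski_functional :: "'a::euclidean_space set \<Rightarrow> 'a \<Rightarrow> real" where
  "minkowski_functional L x =
     (if x = 0 then 0 else (LEAST l. l > 0 \<and> x \<in> (*\<^sub>R) l ` L))"

definition relative_inradius :: "'a::euclidean_space set \<Rightarrow> 'a set \<Rightarrow> real" where
  "relative_inradius K L = (GREATEST R. R > 0 \<and> (*\<^sub>R) R ` L \<subseteq> K)"

(* Borell's definition, for probability measures on the Borel sets.  Minkowski
   combinations of compact sets are compact, so every set below is measurable. *)
definition log_concave_measure :: "'a::euclidean_space measure \<Rightarrow> bool" where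
  "log_concave_measure M \<longleftrightarrow>
     sets M = sets borel \<and>
     (\<forall>A B. \<forall>l\<in>{0<..<1}. compact A \<longrightarrow> compact B \<longrightarrow>
        measure M A powr (1 - l) * measure M B powr l
          \<le> measure M {(1 - l) *\<^sub>R a + l *\<^sub>R b | a b. a \<in> A \<and> b \<in> B})"

end

theory Submission
  imports Defs
begin

text \<open>Put \<open>R = r(K,L) t\<close>. Since \<open>r(K,L) L \<subseteq> K\<close>, every point outside \<open>t K\<close> has gauge at least \<open>R\<close>, so there
  the density is at most \<open>exp (- (1 - e) \<phi>(R)) exp (- e \<phi>(gauge x))\<close>, and the last factor is
  integrable. This gives the upper bound.
  Conversely, beyond a supporting hyperplane at a contact point of \<open>r(K,L) L\<close> with \<open>K\<close>, the complement
  of \<open>t K\<close> contains a translate of \<open>d L\<close> on which the gauge is at most \<open>R + 3 d\<close>. With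
  \<open>d = exp (- e \<phi>(R))\<close> its volume costs only a multiple of \<open>e \<phi>(R)\<close> in the exponent, and
  \<open>\<phi>(R + 3 d) \<le> (1 + e) \<phi>(R)\<close> must hold for arbitrarily large \<open>R\<close>, because \<open>\<phi>\<close> is finite
  everywhere. For rapidly growing \<open>\<phi>\<close> this may fail for other large \<open>R\<close>, hence the limes
  superior.\<close>

section \<open>Symmetric convex bodies and their gauges\<close>

lemma mem_scaleR_image_iff:
  fixes x :: "'a::real_vector"
  assumes "c \<noteq> 0"
  shows "x \<in> (*\<^sub>R) c ` S \<longleftrightarrow> inverse c *\<^sub>R x \<in> S"
  using assms by (force simp: image_iff)

text \<open>The origin is the midpoint of an interior point and its reflection, which is interior by
  symmetry.\<close>

lemma zero_interior_symmetric_convex_body: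
  assumes "symmetric_convex_body K"
  shows "0 \<in> interior K"
proof -
  obtain x where x: "x \<in> interior K"
    using assms by (auto simp: symmetric_convex_body_def)
  have "uminus ` K = K"
    using assms by (simp add: symmetric_convex_body_def)
  then have "interior K = uminus ` interior K"
    using interior_negations[of K] by simp
  then have "- x \<in> interior K"
    using x by blast
  moreover have "convex (interior K)"
    using assms by (simp add: symmetric_convex_body_def)
  ultimately have "(1/2) *\<^sub>R x + (1/2) *\<^sub>R (- x) \<in> interior K"
    using x by (intro convexD) auto
  then show ?thesis by simp
qed

lemma symmetric_convex_body_uminus:
  assumes "symmetric_convex_body K" "x \<in> K"
  shows "- x \<in> K"
  using assms unfolding symmetric_convex_body_def by (metis image_eqI)

lemma symmetric_convex_body_bounds:
  assumes "symmetric_convex_body K"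
  obtains e B where "e > 0" "cball 0 e \<subseteq> K" "B > 0" "\<And>x. x \<in> K \<Longrightarrow> norm x \<le> B"
proof -
  obtain e where "e > 0" "cball 0 e \<subseteq> K"
    using zero_interior_symmetric_convex_body[OF assms] by (auto simp: mem_interior_cball)
  moreover have "bounded K"
    using assms by (simp add: symmetric_convex_body_def compact_imp_bounded)
  ultimately show ?thesis
    using that by (auto simp: bounded_pos)
qed

lemma symmetric_convex_body_scaleR_mono:
  assumes K: "symmetric_convex_body K" and "0 \<le> c" "c \<le> d" and x: "x \<in> (*\<^sub>R) c ` K"
  shows "x \<in> (*\<^sub>R) d ` K"
proof (cases "d = 0")
  case True
  with assms show ?thesis by simp
next
  case False
  obtain y where y: "y \<in> K" "x = c *\<^sub>R y" using x by auto
  have "0 \<in> K"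
    using zero_interior_symmetric_convex_body[OF K] interior_subset by blast
  moreover have "convex K"
    using K by (simp add: symmetric_convex_body_def)
  ultimately have "(c / d) *\<^sub>R y + (1 - c / d) *\<^sub>R 0 \<in> K"
    using y assms False by (intro convexD) auto
  then have "d *\<^sub>R ((c / d) *\<^sub>R y) \<in> (*\<^sub>R) d ` K"
    by (metis add.right_neutral image_eqI scaleR_zero_right)
  then show ?thesis using False y by simp
qed

text \<open>\<open>LEAST\<close> over the reals is informative only once a minimum exists. The
  admissible factors are nonempty because \<open>L\<close> contains a ball around 0, stay away from
  0 because \<open>L\<close> is bounded, and form a closed set because \<open>L\<close> is closed,
  so their infimum is attained.\<close>

lemma minkowski_functional_attained:
  assumes L: "symmetric_convex_body L" and "x \<noteq> 0"
  shows "minkowski_functional L x > 0" "x \<in> (*\<^sub>R) (minkowski_functional L x) ` L"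
    "\<And>l. l > 0 \<Longrightarrow> x \<in> (*\<^sub>R) l ` L \<Longrightarrow> minkowski_functional L x \<le> l"
proof -
  obtain e B where e: "e > 0" "cball 0 e \<subseteq> L" and B: "B > 0" "\<And>x. x \<in> L \<Longrightarrow> norm x \<le> B"
    using symmetric_convex_body_bounds[OF L] by metis
  define S where "S = {l. l > 0 \<and> x \<in> (*\<^sub>R) l ` L}"
  have lb: "norm x / B \<le> l" if l: "l \<in> S" for l
  proof -
    obtain y where "y \<in> L" "x = l *\<^sub>R y" "l > 0" using l unfolding S_def by blast
    then have "norm x \<le> l * B" using B by simp
    then show ?thesis using B by (simp add: field_simps)
  qed
  have "(e / norm x) *\<^sub>R x \<in> L"
    using e \<open>x \<noteq> 0\<close> by (intro subsetD[OF e(2)]) simp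
  then have ne: "norm x / e \<in> S"
    using e \<open>x \<noteq> 0\<close> by (simp add: S_def mem_scaleR_image_iff)
  have pos: "0 < norm x / B" using B \<open>x \<noteq> 0\<close> by simp
  have "closed S"
  proof -
    \<comment> \<open>Restricting to factors above the positive bound \<open>norm x / B\<close>
      keeps \<open>inverse\<close> continuous.\<close>
    have "S = {norm x / B..} \<inter> (\<lambda>l. inverse l *\<^sub>R x) -` L"
      using lb pos by (auto simp: S_def mem_scaleR_image_iff)
    moreover have "closed L"
      using L by (simp add: symmetric_convex_body_def compact_imp_closed)
    moreover have "continuous_on {norm x / B..} (\<lambda>l. inverse l *\<^sub>R x)"
      using pos by (intro continuous_intros) auto
    ultimately show ?thesis
      by (metis closed_atLeast continuous_closed_preimage)
  qed
  then have Inf: "Inf S \<in> S"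
    using ne lb by (intro closed_contains_Inf) (auto simp: bdd_below_def)
  have Infle: "Inf S \<le> l" if "l \<in> S" for l
    using that lb by (intro cInf_lower) (auto simp: bdd_below_def)
  have "(LEAST l. l > 0 \<and> x \<in> (*\<^sub>R) l ` L) = Inf S"
    using Inf Infle by (intro Least_equality) (auto simp: S_def)
  then have eq: "minkowski_functional L x = Inf S"
    using \<open>x \<noteq> 0\<close> by (simp add: minkowski_functional_def)
  show "minkowski_functional L x > 0" "x \<in> (*\<^sub>R) (minkowski_functional L x) ` L"
    using Inf unfolding eq S_def by auto
  show "\<And>l. l > 0 \<Longrightarrow> x \<in> (*\<^sub>R) l ` L \<Longrightarrow> minkowski_functional L x \<le> l"
    using Infle unfolding eq S_def by blast
qed

lemma minkowski_functional_nonneg: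
  assumes "symmetric_convex_body L"
  shows "minkowski_functional L x \<ge> 0"
  using minkowski_functional_attained(1)[OF assms, of x]
  by (cases "x = 0") (auto simp: minkowski_functional_def)

lemma minkowski_functional_le_iff:
  assumes L: "symmetric_convex_body L" and "l > 0"
  shows "minkowski_functional L x \<le> l \<longleftrightarrow> x \<in> (*\<^sub>R) l ` L"
proof (cases "x = 0")
  case True
  have "0 \<in> L"
    using zero_interior_symmetric_convex_body[OF L] interior_subset by blast
  with True \<open>l > 0\<close> show ?thesis
    by (simp add: minkowski_functional_def mem_scaleR_image_iff)
next
  case False
  with assms show ?thesis
    by (metis minkowski_functional_attained symmetric_convex_body_scaleR_mono less_imp_le)
qed

lemma minkowski_functional_scaleR_le:
  assumes L: "symmetric_convex_body L" and "c > 0"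
  shows "minkowski_functional L (c *\<^sub>R x) \<le> c * minkowski_functional L x"
proof (cases "x = 0")
  case True
  then show ?thesis by (simp add: minkowski_functional_def)
next
  case False
  note a = minkowski_functional_attained[OF L False]
  then have "c *\<^sub>R x \<in> (*\<^sub>R) (c * minkowski_functional L x) ` L"
    by (metis (no_types, lifting) image_iff scaleR_scaleR)
  then show ?thesis
    using a(1) \<open>c > 0\<close> by (simp add: minkowski_functional_le_iff[OF L])
qed

text \<open>Every sublevel set is closed: it is empty, the origin alone, or a compact dilate of
  \<open>L\<close>.\<close>

lemma borel_measurable_minkowski_functional [measurable]:
  assumes L: "symmetric_convex_body L"
  shows "minkowski_functional L \<in> borel_measurable borel"
proof -
  have "{x. minkowski_functional L x \<le> a} \<in> sets borel" for a
  proof (cases a "0::real" rule: linorder_cases)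
    case less
    then have "{x. minkowski_functional L x \<le> a} = {}"
      using minkowski_functional_nonneg[OF L] by (auto simp: not_le intro: less_le_trans)
    then show ?thesis by simp
  next
    case equal
    then have "{x. minkowski_functional L x \<le> a} = {0}"
      using minkowski_functional_attained(1)[OF L]
      by (force simp: not_le minkowski_functional_def)
    then show ?thesis by simp
  next
    case greater
    then have "{x. minkowski_functional L x \<le> a} = (*\<^sub>R) a ` L"
      by (simp add: minkowski_functional_le_iff[OF L])
    moreover have "compact ((*\<^sub>R) a ` L)"
      using L by (simp add: symmetric_convex_body_def compact_scaling)
    ultimately show ?thesis
      by (simp add: compact_imp_closed)
  qed
  then show ?thesis by (simp add: borel_measurable_iff_le)
qed

section \<open>The relative inradius and its contact points\<close>

text \<open>Compactness shows that the maximum behind \<open>GREATEST\<close> exists. By maximality,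
  every slightly larger dilate of \<open>L\<close> has a point outside \<open>K\<close>; a limit of
  such points is the contact point.\<close>

lemma relative_inradius_contact:
  fixes K L :: "'a::euclidean_space set"
  assumes K: "symmetric_convex_body K" and L: "symmetric_convex_body L"
  shows "relative_inradius K L > 0" "(*\<^sub>R) (relative_inradius K L) ` L \<subseteq> K"
    "\<exists>x\<in>L. relative_inradius K L *\<^sub>R x \<notin> interior K"
proof -
  obtain a A where a: "a > 0" "cball 0 a \<subseteq> K" and A: "A > 0" "\<And>x. x \<in> K \<Longrightarrow> norm x \<le> A"
    using symmetric_convex_body_bounds[OF K] by metis
  obtain b B where b: "b > 0" "cball 0 b \<subseteq> L" and B: "B > 0" "\<And>x. x \<in> L \<Longrightarrow> norm x \<le> B"
    using symmetric_convex_body_bounds[OF L] by metis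
  have closed: "closed K" and compact: "compact L"
    using K L by (auto simp: symmetric_convex_body_def compact_imp_closed)
  define S where "S = {R. R > 0 \<and> (*\<^sub>R) R ` L \<subseteq> K}"
  have "a / B \<in> S"
  proof -
    have "(a / B) *\<^sub>R y \<in> K" if "y \<in> L" for y
      using a B(1) B(2)[OF that] by (intro subsetD[OF a(2)]) (simp add: field_simps)
    then show ?thesis using a B by (auto simp: S_def)
  qed
  have ub: "R \<le> A / b" if "R \<in> S" for R
  proof -
    obtain i :: 'a where "i \<in> Basis" using nonempty_Basis by blast
    then have "b *\<^sub>R i \<in> L"
      using b by (intro subsetD[OF b(2)]) simp
    then have "norm (R *\<^sub>R b *\<^sub>R i) \<le> A"
      using that by (intro A) (auto simp: S_def)
    then show ?thesis
      using \<open>i \<in> Basis\<close> that b by (simp add: S_def field_simps)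
  qed
  define r where "r = Sup S"
  have le_r: "R \<le> r" if "R \<in> S" for R
    unfolding r_def using that ub by (intro cSup_upper) (auto simp: bdd_above_def)
  have "r > 0"
    using le_r[OF \<open>a / B \<in> S\<close>] a B by (smt (verit) divide_pos_pos)
  have rK: "r *\<^sub>R y \<in> K" if "y \<in> L" for y
  proof -
    \<comment> \<open>For fixed \<open>y\<close> the factors that keep \<open>y\<close> in
      \<open>K\<close> form a closed set containing \<open>S\<close>, hence also the supremum of
      \<open>S\<close>.\<close>
    have "closed ((\<lambda>R. R *\<^sub>R y) -` K)"
      using closed by (intro closed_vimage continuous_intros)
    moreover have "S \<subseteq> (\<lambda>R. R *\<^sub>R y) -` K"
      using that by (auto simp: S_def)
    ultimately show ?thesis
      using closed_subset_contains_Sup[of "(\<lambda>R. R *\<^sub>R y) -` K" S] \<open>a / B \<in> S\<close> ub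
      by (fastforce simp: r_def)
  qed
  have "relative_inradius K L = r"
    unfolding relative_inradius_def
    using \<open>r > 0\<close> rK le_r by (intro Greatest_equality) (auto simp: S_def)
  moreover have "\<exists>x\<in>L. r *\<^sub>R x \<notin> interior K"
  proof -
    have "\<exists>y\<in>L. (r + inverse (real (Suc n))) *\<^sub>R y \<notin> K" for n
    proof (rule ccontr)
      assume "\<not> ?thesis"
      then have "r + inverse (real (Suc n)) \<in> S"
        using \<open>r > 0\<close> by (auto simp: S_def add_pos_pos)
      from le_r[OF this] show False by simp
    qed
    then obtain y where y: "\<And>n. y n \<in> L" "\<And>n. (r + inverse (real (Suc n))) *\<^sub>R y n \<notin> K"
      by metis
    obtain x f where x: "x \<in> L" "strict_mono (f :: nat \<Rightarrow> nat)" "(y \<circ> f) \<longlonglongrightarrow> x"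
      using compact y(1) unfolding compact_def by metis
    have "(\<lambda>n. inverse (real (Suc (f n)))) \<longlonglongrightarrow> 0"
      using LIMSEQ_subseq_LIMSEQ[OF LIMSEQ_inverse_real_of_nat x(2)] by (simp add: o_def)
    then have lim: "(\<lambda>n. (r + inverse (real (Suc (f n)))) *\<^sub>R (y \<circ> f) n) \<longlonglongrightarrow> (r + 0) *\<^sub>R x"
      using x(3) by (intro tendsto_intros)
    have mem: "(r + inverse (real (Suc (f n)))) *\<^sub>R (y \<circ> f) n \<in> - interior K" for n
      using y(2)[of "f n"] interior_subset[of K] unfolding o_def by blast
    have "closed (- interior K)" by (intro closed_Compl open_interior)
    from closed_sequentially[OF this mem lim] have "(r + 0) *\<^sub>R x \<in> - interior K" .
    then show ?thesis using x(1) by auto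
  qed
  ultimately show "relative_inradius K L > 0" "(*\<^sub>R) (relative_inradius K L) ` L \<subseteq> K"
    "\<exists>x\<in>L. relative_inradius K L *\<^sub>R x \<notin> interior K"
    using \<open>r > 0\<close> rK by auto
qed

text \<open>\<open>u\<close> is the normal of a hyperplane supporting \<open>K\<close> at a contact
  point \<open>r x\<close>, scaled so that \<open>u \<bullet> x = 1\<close>. The hyperplane then
  sits at level \<open>r\<close>.\<close>

lemma relative_inradius_supporting_functional:
  fixes K L :: "'a::euclidean_space set"
  assumes K: "symmetric_convex_body K" and L: "symmetric_convex_body L"
  obtains x u where "x \<in> L" "u \<bullet> x = 1" "\<And>y. y \<in> K \<Longrightarrow> u \<bullet> y \<le> relative_inradius K L"
proof -
  define r where "r = relative_inradius K L"
  note c = relative_inradius_contact[OF K L, folded r_def]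
  obtain x where x: "x \<in> L" "r *\<^sub>R x \<notin> interior K" using c(3) by auto
  have 0: "0 \<in> interior K" by (rule zero_interior_symmetric_convex_body[OF K])
  have ri: "rel_interior K = interior K"
    using 0 by (intro rel_interior_nonempty_interior) auto
  have "convex K" using K by (simp add: symmetric_convex_body_def)
  then obtain a where a: "\<And>y. y \<in> closure K \<Longrightarrow> a \<bullet> (r *\<^sub>R x) \<le> a \<bullet> y"
      "\<And>y. y \<in> rel_interior K \<Longrightarrow> a \<bullet> (r *\<^sub>R x) < a \<bullet> y"
    using supporting_hyperplane_relative_frontier[of K "r *\<^sub>R x"] x c(2) ri closure_subset[of K]
    by (metis image_eqI subsetD)
  have neg: "a \<bullet> x < 0"
    using a(2)[of 0] 0 ri c(1) by (simp add: mult_less_0_iff)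
  \<comment> \<open>The normal \<open>a\<close> bounds \<open>K\<close> from below; division by the
    negative number \<open>a \<bullet> x\<close> reverses the inequality and normalises.\<close>
  define u where "u = (1 / (a \<bullet> x)) *\<^sub>R a"
  have "u \<bullet> x = 1" using neg by (simp add: u_def)
  moreover have "u \<bullet> y \<le> r" if "y \<in> K" for y
    using a(1)[of y] that closure_subset[of K] neg by (auto simp: u_def field_simps)
  ultimately show ?thesis using that x(1) unfolding r_def by blast
qed

section \<open>A criterion for the limes superior, and slow growth at arbitrarily large
  arguments\<close>

text \<open>Additive constants vanish in the ratio because \<open>p\<close> tends to infinity. The
  upper estimate must hold eventually, but for the lower one it is enough that it recurs, which is
  all that rapidly growing \<phi> permits.\<close>

lemma Limsup_ratio_eq_minus_one:
  fixes f p :: "'a \<Rightarrow> real"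
  assumes p: "filterlim p at_top F"
    and upper: "\<And>e. 0 < e \<Longrightarrow> e < 1 \<Longrightarrow> \<exists>C. \<forall>\<^sub>F t in F. f t \<le> C - (1 - e) * p t"
    and lower: "\<And>e. 0 < e \<Longrightarrow> \<exists>C. \<exists>\<^sub>F t in F. C - (1 + e) * p t \<le> f t"
  shows "Limsup F (\<lambda>t. ereal (f t / p t)) = ereal (- 1)"
proof (rule antisym)
  have ev: "\<forall>\<^sub>F t in F. p t > 0 \<and> \<bar>C\<bar> \<le> e / 2 * p t" if "e > 0" for e C :: real
  proof -
    have "\<forall>\<^sub>F t in F. p t > 0 \<and> p t \<ge> 2 * \<bar>C\<bar> / e"
      using p unfolding filterlim_at_top_dense
      by (intro eventually_conj) (blast intro: eventually_mono less_imp_le)+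
    then show ?thesis
      by eventually_elim (use that in \<open>simp add: field_simps\<close>)
  qed
  show "Limsup F (\<lambda>t. ereal (f t / p t)) \<le> ereal (- 1)"
  proof (rule ereal_le_epsilon2)
    fix e :: real assume "e > 0"
    \<comment> \<open>Half of \<open>e\<close> pays for the loss in the exponent and half for the
      constant \<open>C\<close>; the cap \<open>1 / 2\<close> meets the condition
      \<open>d < 1\<close> of \<open>upper\<close>.\<close>
    define d where "d = min (e / 2) (1 / 2)"
    have d: "0 < d" "d < 1" "d \<le> e / 2" using \<open>e > 0\<close> by (auto simp: d_def)
    obtain C where "\<forall>\<^sub>F t in F. f t \<le> C - (1 - d) * p t" using upper[OF d(1,2)] by blast
    with ev[OF \<open>e > 0\<close>, of C] have "\<forall>\<^sub>F t in F. f t / p t \<le> - 1 + e"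
    proof eventually_elim
      case (elim t)
      have "d * p t \<le> e / 2 * p t" using d elim by (intro mult_right_mono) auto
      moreover have "f t \<le> C - p t + d * p t" using elim by (simp add: left_diff_distrib)
      moreover have "(- 1 + e) * p t = e / 2 * p t + e / 2 * p t - p t" by (simp add: field_simps)
      ultimately have "f t \<le> (- 1 + e) * p t" using elim by linarith
      then show ?case using elim by (simp add: field_simps)
    qed
    then show "Limsup F (\<lambda>t. ereal (f t / p t)) \<le> ereal (- 1) + ereal e"
      by (intro Limsup_bounded) simp
  qed
  show "ereal (- 1) \<le> Limsup F (\<lambda>t. ereal (f t / p t))"
  proof (rule ereal_le_epsilon2)
    fix e :: real assume "e > 0"
    show "ereal (- 1) \<le> Limsup F (\<lambda>t. ereal (f t / p t)) + ereal e"
    proof (rule ccontr)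
      assume "\<not> ?thesis"
      then have "Limsup F (\<lambda>t. ereal (f t / p t)) < ereal (- 1 - e)"
        by (cases "Limsup F (\<lambda>t. ereal (f t / p t))") auto
      then have less: "\<forall>\<^sub>F t in F. f t / p t < - 1 - e"
        by (auto dest: Limsup_lessD)
      obtain C where C: "\<exists>\<^sub>F t in F. C - (1 + e / 2) * p t \<le> f t"
        using lower[of "e / 2"] \<open>e > 0\<close> by auto
      from less ev[OF \<open>e > 0\<close>, of C] have "\<forall>\<^sub>F t in F. \<not> C - (1 + e / 2) * p t \<le> f t"
      proof eventually_elim
        case (elim t)
        then have "f t < (- 1 - e) * p t" by (simp add: divide_less_eq)
        moreover have "(- 1 - e) * p t = - (e / 2 * p t) - (1 + e / 2) * p t" by (simp add: field_simps)
        ultimately show ?case using elim by linarith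
      qed
      with C show False by (simp add: frequently_def)
    qed
  qed
qed

text \<open>If this failed from \<open>R\<^sub>0\<close> on, iterating \<open>R \<mapsto> R + 3 exp (- e \<phi> R)\<close> would give a
  bounded sequence (the increments decay geometrically) along which \<open>\<phi>\<close> grows geometrically.\<close>
lemma mono_unbounded_slow_growth:
  fixes \<phi> :: "real \<Rightarrow> real"
  assumes mono: "mono_on {0..} \<phi>" and lim: "filterlim \<phi> at_top at_top" and "e > 0"
  shows "\<exists>R\<ge>T. \<phi> (R + 3 * exp (- e * \<phi> R)) \<le> (1 + e) * \<phi> R"
proof (rule ccontr)
  assume "\<not> ?thesis"
  then have grow: "\<phi> (R + 3 * exp (- e * \<phi> R)) > (1 + e) * \<phi> R" if "R \<ge> T" for R
    using that by force
  have "\<forall>\<^sub>F R in at_top. \<phi> R \<ge> 1 \<and> R \<ge> max 0 T"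
    using lim by (intro eventually_conj eventually_ge_at_top) (simp add: filterlim_at_top)
  then obtain R0 where R0: "\<phi> R0 \<ge> 1" "R0 \<ge> 0" "R0 \<ge> T"
    by (auto simp: eventually_at_top_linorder)
  define R where "R k = ((\<lambda>R. R + 3 * exp (- e * \<phi> R)) ^^ k) R0" for k
  define q where "q = 1 / (1 + e)"
  \<comment> \<open>The total of the increments: the series of \<open>3 / e * q ^ k\<close>.\<close>
  define C where "C = 3 / (e * (1 - q))"
  have q: "0 < q" "q < 1" using \<open>e > 0\<close> by (auto simp: q_def)
  have "C > 0" using q \<open>e > 0\<close> by (simp add: C_def)
  have R_Suc: "R (Suc k) = R k + 3 * exp (- e * \<phi> (R k))" for k
    by (simp add: R_def)
  have R_ge: "R k \<ge> R0" for k
    by (induction k) (auto simp: R_Suc add_increasing2, simp add: R_def)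
  have pow: "\<phi> (R k) \<ge> (1 + e) ^ k" for k
  proof (induction k)
    case 0
    then show ?case using R0 by (simp add: R_def)
  next
    case (Suc k)
    have "(1 + e) ^ Suc k \<le> (1 + e) * \<phi> (R k)" using Suc \<open>e > 0\<close> by simp
    also have "\<dots> \<le> \<phi> (R (Suc k))"
      using grow[of "R k"] R_ge[of k] R0 by (simp add: R_Suc)
    finally show ?case .
  qed
  have R_le: "R k \<le> R0 + C * (1 - q ^ k)" for k
  proof (induction k)
    case 0
    then show ?case by (simp add: R_def)
  next
    case (Suc k)
    \<comment> \<open>The bound \<open>exp s \<ge> 1 + s\<close> turns geometric growth of \<phi>
      into geometric decay of the increments.\<close>
    have "e * (1 + e) ^ k \<le> exp (e * \<phi> (R k))"
      using pow[of k] \<open>e > 0\<close> exp_ge_add_one_self[of "e * \<phi> (R k)"]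
      by (smt (verit) mult_left_mono)
    then have "inverse (exp (e * \<phi> (R k))) \<le> inverse (e * (1 + e) ^ k)"
      using \<open>e > 0\<close> by (intro le_imp_inverse_le) auto
    then have "3 * exp (- e * \<phi> (R k)) \<le> 3 * inverse (e * (1 + e) ^ k)"
      by (simp add: exp_minus)
    also have "\<dots> = C * (1 - q) * q ^ k"
    proof -
      have "C * (1 - q) = 3 / e" using q \<open>e > 0\<close> by (simp add: C_def divide_simps)
      then show ?thesis by (simp add: q_def power_divide divide_simps)
    qed
    finally show ?case using Suc by (simp add: R_Suc algebra_simps)
  qed
  have bound: "(1 + e) ^ k \<le> \<phi> (R0 + C)" for k
  proof -
    have "R k \<le> R0 + C"
      using R_le[of k] q \<open>C > 0\<close> by (smt (verit) mult_left_le zero_le_power)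
    then have "\<phi> (R k) \<le> \<phi> (R0 + C)"
      using R0 R_ge[of k] by (intro mono_onD[OF mono]) auto
    with pow[of k] show ?thesis by simp
  qed
  obtain k where "\<phi> (R0 + C) < (1 + e) ^ k"
    using real_arch_pow[of "1 + e"] \<open>e > 0\<close> by auto
  with bound[of k] show False by simp
qed

section \<open>Probability measures whose density depends on the gauge\<close>

locale gauge_density =
  fixes L :: "'a::euclidean_space set" and \<phi> :: "real \<Rightarrow> real" and \<mu> :: "'a measure"
  assumes L: "symmetric_convex_body L"
    and nonneg: "\<And>s. s \<ge> 0 \<Longrightarrow> \<phi> s \<ge> 0"
    and convex: "convex_on {0..} \<phi>"
    and mono: "mono_on {0..} \<phi>"
    and prob: "prob_space \<mu>"
    and density: "\<mu> = density lborel (\<lambda>x. ennreal (exp (- \<phi> (minkowski_functional L x))))"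
begin

abbreviation gauge :: "'a \<Rightarrow> real" where "gauge \<equiv> minkowski_functional L"

lemma gauge_nonneg: "gauge x \<ge> 0"
  by (rule minkowski_functional_nonneg[OF L])

lemma phi_mono: "0 \<le> s \<Longrightarrow> s \<le> t \<Longrightarrow> \<phi> s \<le> \<phi> t"
  using mono by (auto intro: mono_onD)

lemma measurable_phi_gauge [measurable]: "(\<lambda>x. \<phi> (gauge x)) \<in> borel_measurable borel"
proof -
  \<comment> \<open>\<phi> is monotone only on the nonnegative reals; truncation makes it monotone
    everywhere and changes nothing at values of the gauge.\<close>
  have "(\<lambda>s. \<phi> (max 0 s)) \<in> borel_measurable borel"
    by (intro borel_measurable_mono monoI phi_mono) auto
  from measurable_compose[OF borel_measurable_minkowski_functional[OF L] this]
  show ?thesis using gauge_nonneg by (simp add: max_def)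
qed

lemma sets_mu [measurable_cong]: "sets \<mu> = sets borel"
  by (simp add: density)

lemma emeasure_mu:
  "A \<in> sets borel \<Longrightarrow>
    emeasure \<mu> A = (\<integral>\<^sup>+x. ennreal (exp (- \<phi> (gauge x))) * indicator A x \<partial>lborel)"
  unfolding density by (intro emeasure_density) auto

lemma nn_integral_mu_density: "(\<integral>\<^sup>+x. ennreal (exp (- \<phi> (gauge x))) \<partial>lborel) = 1"
proof -
  have "emeasure \<mu> UNIV = 1"
    using prob_space.emeasure_space_1[OF prob] by (simp add: density)
  then show ?thesis by (simp add: emeasure_mu)
qed

text \<open>If \<phi> were bounded, the density would be bounded below by a positive constant and
  the total mass would be infinite. Monotonicity turns unboundedness into divergence.\<close>

lemma phi_at_top: "filterlim \<phi> at_top at_top"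
proof -
  have "\<exists>s\<ge>0. \<phi> s > Z" for Z
  proof (rule ccontr)
    assume "\<not> ?thesis"
    then have le: "\<phi> (gauge x) \<le> Z" for x
      using gauge_nonneg[of x] by force
    have "(\<integral>\<^sup>+x. ennreal (exp (- Z)) \<partial>(lborel :: 'a measure))
        \<le> (\<integral>\<^sup>+x. ennreal (exp (- \<phi> (gauge x))) \<partial>lborel)"
      using le by (intro nn_integral_mono ennreal_leI) simp
    then show False
      by (simp add: nn_integral_mu_density ennreal_mult_top top_unique)
  qed
  then show ?thesis
    unfolding filterlim_at_top eventually_at_top_linorder
    by (meson phi_mono less_imp_le order_trans)
qed

text \<open>Convexity turns \<open>e \<phi>(s)\<close> into \<open>\<phi>(e s)\<close> up to a constant, so that the integral
  reduces to the total mass by the substitution \<open>x \<mapsto> e x\<close>.\<close>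
lemma nn_integral_density_powr_finite:
  assumes e: "0 < e" "e < 1"
  shows "(\<integral>\<^sup>+x. ennreal (exp (- e * \<phi> (gauge x))) \<partial>lborel) < \<infinity>"
proof -
  have *: "\<phi> (gauge (e *\<^sub>R x)) \<le> e * \<phi> (gauge x) + \<phi> 0" for x
  proof -
    have "\<phi> (gauge (e *\<^sub>R x)) \<le> \<phi> ((1 - e) *\<^sub>R 0 + e *\<^sub>R gauge x)"
      using minkowski_functional_scaleR_le[OF L e(1)] gauge_nonneg by (intro phi_mono) auto
    also have "\<dots> \<le> (1 - e) * \<phi> 0 + e * \<phi> (gauge x)"
      using e gauge_nonneg by (intro convex_onD[OF convex]) auto
    also have "\<dots> \<le> e * \<phi> (gauge x) + \<phi> 0"
      using e nonneg[of 0] by (simp add: algebra_simps)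
    finally show ?thesis .
  qed
  \<comment> \<open>Lebesgue measure is its own image under \<open>x \<mapsto> e x\<close>, weighted
    by the Jacobian \<open>e ^ DIM('a)\<close>.\<close>
  have "1 = (\<integral>\<^sup>+x. ennreal (exp (- \<phi> (gauge x)))
              \<partial>density (distr lborel borel (\<lambda>x. 0 + e *\<^sub>R x)) (\<lambda>_. \<bar>e\<bar> ^ DIM('a)))"
    using e by (subst lborel_affine[symmetric]) (auto simp: nn_integral_mu_density)
  also have "\<dots> = (\<integral>\<^sup>+x. ennreal (e ^ DIM('a)) * ennreal (exp (- \<phi> (gauge (e *\<^sub>R x)))) \<partial>lborel)"
    using e by (simp add: nn_integral_density nn_integral_distr nn_integral_cmult)
  finally have one: "(\<integral>\<^sup>+x. ennreal (e ^ DIM('a)) * ennreal (exp (- \<phi> (gauge (e *\<^sub>R x)))) \<partial>lborel) = 1"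
    by simp
  have "ennreal (exp (- \<phi> 0) * e ^ DIM('a)) * (\<integral>\<^sup>+x. ennreal (exp (- e * \<phi> (gauge x))) \<partial>lborel)
      = (\<integral>\<^sup>+x. ennreal (exp (- \<phi> 0) * e ^ DIM('a)) * ennreal (exp (- e * \<phi> (gauge x))) \<partial>lborel)"
    by (intro nn_integral_cmult[symmetric]) simp
  also have "\<dots> \<le> (\<integral>\<^sup>+x. ennreal (e ^ DIM('a)) * ennreal (exp (- \<phi> (gauge (e *\<^sub>R x)))) \<partial>lborel)"
  proof (intro nn_integral_mono)
    fix x
    have "exp (- \<phi> 0) * exp (- e * \<phi> (gauge x)) \<le> exp (- \<phi> (gauge (e *\<^sub>R x)))"
      using *[of x] by (simp flip: exp_add)
    then have "e ^ DIM('a) * (exp (- \<phi> 0) * exp (- e * \<phi> (gauge x)))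
        \<le> e ^ DIM('a) * exp (- \<phi> (gauge (e *\<^sub>R x)))"
      using e by (intro mult_left_mono) auto
    then show "ennreal (exp (- \<phi> 0) * e ^ DIM('a)) * ennreal (exp (- e * \<phi> (gauge x)))
        \<le> ennreal (e ^ DIM('a)) * ennreal (exp (- \<phi> (gauge (e *\<^sub>R x))))"
      using e by (simp add: ennreal_mult[symmetric] ennreal_leI mult_ac)
  qed
  finally have le: "ennreal (exp (- \<phi> 0) * e ^ DIM('a)) *
      (\<integral>\<^sup>+x. ennreal (exp (- e * \<phi> (gauge x))) \<partial>lborel) \<le> 1"
    using one by simp
  \<comment> \<open>An infinite integral times a nonzero constant would be infinite, against the
    bound 1.\<close>
  have "ennreal (exp (- \<phi> 0) * e ^ DIM('a)) \<noteq> 0" using e by simp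
  with le show ?thesis
    by (metis ennreal_mult_top infinity_ennreal_def less_top linorder_not_le ennreal_one_less_top)
qed

section \<open>Upper bound for sets of large gauge\<close>

text \<open>The share \<open>1 - e\<close> of the exponent is bounded by its value at
  \<open>R\<close>, and the share \<open>e\<close> is kept to make the integral converge. The
  constant is therefore uniform in \<open>A\<close> and \<open>R\<close>.\<close>

lemma tail_upper_bound:
  assumes e: "0 < e" "e < 1"
  obtains C where "C > 0"
    "\<And>A R. A \<in> sets borel \<Longrightarrow> R \<ge> 0 \<Longrightarrow> (\<And>x. x \<in> A \<Longrightarrow> R \<le> gauge x) \<Longrightarrow>
      measure \<mu> A \<le> C * exp (- (1 - e) * \<phi> R)"
proof -
  define I where "I = (\<integral>\<^sup>+x. ennreal (exp (- e * \<phi> (gauge x))) \<partial>lborel)"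
  have I: "I < \<infinity>" unfolding I_def by (rule nn_integral_density_powr_finite[OF e])
  show ?thesis
  \<comment> \<open>The added 1 makes the constant visibly positive, so that its logarithm can be
    split off later.\<close>
  proof (rule that[of "enn2real I + 1"])
    show "enn2real I + 1 > 0" by (simp add: add_nonneg_pos)
    fix A R assume A: "A \<in> sets borel" "R \<ge> 0" "\<And>x. x \<in> A \<Longrightarrow> R \<le> gauge x"
    have "emeasure \<mu> A = (\<integral>\<^sup>+x. ennreal (exp (- \<phi> (gauge x))) * indicator A x \<partial>lborel)"
      by (rule emeasure_mu[OF A(1)])
    also have "\<dots> \<le> (\<integral>\<^sup>+x. ennreal (exp (- (1 - e) * \<phi> R)) * ennreal (exp (- e * \<phi> (gauge x))) \<partial>lborel)"
    proof (intro nn_integral_mono)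
      fix x
      have "exp (- \<phi> (gauge x)) \<le> exp (- (1 - e) * \<phi> R) * exp (- e * \<phi> (gauge x))" if "x \<in> A"
      proof -
        have "(1 - e) * \<phi> R \<le> (1 - e) * \<phi> (gauge x)"
          using A that e by (intro mult_left_mono phi_mono) auto
        then show ?thesis by (simp flip: exp_add add: algebra_simps)
      qed
      then show "ennreal (exp (- \<phi> (gauge x))) * indicator A x
          \<le> ennreal (exp (- (1 - e) * \<phi> R)) * ennreal (exp (- e * \<phi> (gauge x)))"
        by (auto simp: indicator_def simp flip: ennreal_mult intro!: ennreal_leI)
    qed
    also have "\<dots> = ennreal (exp (- (1 - e) * \<phi> R)) * I"
      unfolding I_def by (intro nn_integral_cmult) simp
    also have "\<dots> = ennreal (exp (- (1 - e) * \<phi> R) * enn2real I)"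
      using I by (simp add: ennreal_mult)
    finally have "measure \<mu> A \<le> exp (- (1 - e) * \<phi> R) * enn2real I"
      by (simp add: measure_def enn2real_leI)
    also have "\<dots> \<le> (enn2real I + 1) * exp (- (1 - e) * \<phi> R)"
      by (simp add: algebra_simps)
    finally show "measure \<mu> A \<le> (enn2real I + 1) * exp (- (1 - e) * \<phi> R)" .
  qed
qed

section \<open>Lower bound from small copies of \<open>L\<close>\<close>

text \<open>On the copy the density is at least \<open>exp (- \<phi> R)\<close>, and scaling by
  \<open>d\<close> multiplies the volume by \<open>d ^ DIM('a)\<close>.\<close>

lemma measure_affine_image_lower_bound:
  assumes "d > 0" "R \<ge> 0" and le: "\<And>x. x \<in> (\<lambda>x. d *\<^sub>R x + v) ` L \<Longrightarrow> gauge x \<le> R"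
  shows "exp (- \<phi> R) * (d ^ DIM('a) * measure lebesgue L) \<le> measure \<mu> ((\<lambda>x. d *\<^sub>R x + v) ` L)"
proof -
  let ?S = "(\<lambda>x. d *\<^sub>R x + v) ` L"
  have "compact ?S"
    using L unfolding symmetric_convex_body_def
    by (intro compact_continuous_image continuous_intros) auto
  then have S: "?S \<in> sets borel" "emeasure lborel ?S < \<infinity>"
    using emeasure_compact_finite by (blast intro: borel_closed compact_imp_closed)+
  have "measure lborel ?S = d ^ DIM('a) * measure lebesgue L"
    using measure_lebesgue_affine[of d v L] S \<open>d > 0\<close> by (simp add: measure_completion)
  then have "ennreal (exp (- \<phi> R) * (d ^ DIM('a) * measure lebesgue L))
      = ennreal (exp (- \<phi> R)) * emeasure lborel ?S"
    using S(2) by (metis emeasure_eq_ennreal_measure ennreal_mult exp_ge_zero infinity_ennreal_def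
        less_irrefl measure_nonneg)
  also have "\<dots> = (\<integral>\<^sup>+x. ennreal (exp (- \<phi> R)) * indicator ?S x \<partial>lborel)"
    using S by (simp add: nn_integral_cmult_indicator)
  also have "\<dots> \<le> (\<integral>\<^sup>+x. ennreal (exp (- \<phi> (gauge x))) * indicator ?S x \<partial>lborel)"
  proof (intro nn_integral_mono)
    fix x
    show "ennreal (exp (- \<phi> R)) * indicator ?S x \<le> ennreal (exp (- \<phi> (gauge x))) * indicator ?S x"
      using phi_mono[OF gauge_nonneg le, of x] by (cases "x \<in> ?S") (auto intro!: ennreal_leI)
  qed
  also have "\<dots> = emeasure \<mu> ?S" by (rule emeasure_mu[OF S(1), symmetric])
  also have "\<dots> = ennreal (measure \<mu> ?S)"
    using prob_space.finite_measure[OF prob] by (rule finite_measure.emeasure_eq_measure)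
  finally show ?thesis by (simp add: ennreal_le_iff)
qed

end

lemma measure_symmetric_convex_body_pos:
  assumes L: "symmetric_convex_body L"
  shows "measure lebesgue L > 0"
proof -
  obtain e where e: "e > 0" "cball 0 e \<subseteq> L"
    using symmetric_convex_body_bounds[OF L] by metis
  have "0 < measure lebesgue (cball (0::'a) e)"
    using e by (simp add: content_cball_pos)
  also have "\<dots> \<le> measure lebesgue L"
    using L e by (intro measure_mono_fmeasurable lmeasurable_compact) (auto simp: symmetric_convex_body_def)
  finally show ?thesis .
qed

context gauge_density
begin

text \<open>The witness is a copy of \<open>d L\<close> placed beyond the supporting hyperplane of \<open>t K\<close>
  at a contact point with \<open>r(K,L) t L\<close>.\<close>
lemma measure_complement_lower_bound:
  assumes K: "symmetric_convex_body K" and "t > 0" "d > 0"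
  shows "exp (- \<phi> (relative_inradius K L * t + 3 * d)) * (d ^ DIM('a) * measure lebesgue L)
    \<le> measure \<mu> (- ((*\<^sub>R) t ` K))"
proof -
  define r where "r = relative_inradius K L"
  note c = relative_inradius_contact[OF K L, folded r_def]
  obtain x u where x: "x \<in> L" "u \<bullet> x = 1" and u: "\<And>y. y \<in> K \<Longrightarrow> u \<bullet> y \<le> r"
    using relative_inradius_supporting_functional[OF K L] unfolding r_def by metis
  define N where "N = r * t + 3 * d"
  have "r * t > 0" using c(1) \<open>t > 0\<close> by simp
  then have N: "N > 0" "r * t + 2 * d > 0" using \<open>d > 0\<close> by (auto simp: N_def)
  \<comment> \<open>The shift \<open>2 * d\<close> leaves room on both sides: on \<open>d L\<close>
    the functional \<open>u\<close> is at least \<open>- d\<close>, so \<open>u\<close> is at least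
    \<open>r * t + d\<close> on \<open>S\<close>, while the gauge there is at most
    \<open>d + (r * t + 2 * d) = N\<close>.\<close>
  define S where "S = (\<lambda>y. d *\<^sub>R y + (r * t + 2 * d) *\<^sub>R x) ` L"
  have "convex L" "compact K" using K L by (auto simp: symmetric_convex_body_def)
  have gauge_le: "gauge z \<le> N" if z: "z \<in> S" for z
  proof -
    obtain y where y: "y \<in> L" "z = d *\<^sub>R y + (r * t + 2 * d) *\<^sub>R x" using z by (auto simp: S_def)
    have "(d / N) *\<^sub>R y + ((r * t + 2 * d) / N) *\<^sub>R x \<in> L"
      using x y N \<open>d > 0\<close>
      by (intro convexD[OF \<open>convex L\<close>]) (auto simp: N_def simp flip: add_divide_distrib)
    moreover have "(d / N) *\<^sub>R y + ((r * t + 2 * d) / N) *\<^sub>R x = inverse N *\<^sub>R z"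
      by (simp add: y(2) scaleR_add_right divide_inverse_commute)
    ultimately show ?thesis
      using N by (simp add: minkowski_functional_le_iff[OF L] mem_scaleR_image_iff)
  qed
  have "z \<notin> (*\<^sub>R) t ` K" if z: "z \<in> S" for z
  proof
    assume "z \<in> (*\<^sub>R) t ` K"
    then have "u \<bullet> z \<le> t * r" using u \<open>t > 0\<close> by auto
    moreover obtain y where y: "y \<in> L" "z = d *\<^sub>R y + (r * t + 2 * d) *\<^sub>R x"
      using z by (auto simp: S_def)
    \<comment> \<open>Symmetry of \<open>L\<close> turns the upper bound for \<open>u\<close> on
      \<open>K\<close> into a lower bound for \<open>u\<close> on \<open>L\<close>.\<close>
    have "r *\<^sub>R (- y) \<in> K"
      using c(2) symmetric_convex_body_uminus[OF L y(1)] by blast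
    from u[OF this] have "r * (- 1) \<le> r * (u \<bullet> y)" by simp
    then have "u \<bullet> y \<ge> - 1" using c(1) by (simp only: mult_le_cancel_left_pos)
    then have "d * (u \<bullet> y) \<ge> d * (- 1)" using \<open>d > 0\<close> by (intro mult_left_mono) auto
    then have "u \<bullet> z \<ge> r * t + d" by (simp add: y(2) inner_add_right x(2))
    ultimately show False using \<open>d > 0\<close> by (simp add: mult.commute)
  qed
  then have sub: "S \<subseteq> - ((*\<^sub>R) t ` K)" by blast
  have "compact ((*\<^sub>R) t ` K)" using \<open>compact K\<close> by (rule compact_scaling)
  then have "- ((*\<^sub>R) t ` K) \<in> sets \<mu>" by (simp add: sets_mu borel_open compact_imp_closed open_Compl)
  with sub have "measure \<mu> S \<le> measure \<mu> (- ((*\<^sub>R) t ` K))"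
    using prob_space.finite_measure[OF prob] by (intro finite_measure.finite_measure_mono) auto
  moreover have "exp (- \<phi> N) * (d ^ DIM('a) * measure lebesgue L) \<le> measure \<mu> S"
    using measure_affine_image_lower_bound[of d N "(r * t + 2 * d) *\<^sub>R x"] gauge_le N \<open>d > 0\<close>
    unfolding S_def by simp
  ultimately show ?thesis unfolding N_def r_def by simp
qed

section \<open>The limes superior\<close>

lemma Limsup_ln_measure_complement:
  assumes K: "symmetric_convex_body K"
  shows "Limsup at_top (\<lambda>t::real.
           ereal (ln (measure \<mu> (- ((*\<^sub>R) t ` K))) / \<phi> (relative_inradius K L * t))) = ereal (- 1)"
proof -
  define r where "r = relative_inradius K L"
  define n where "n = DIM('a)"
  define V where "V = measure lebesgue L"
  note c = relative_inradius_contact[OF K L, folded r_def]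
  have "r > 0" by (rule c(1))
  have "V > 0" unfolding V_def by (rule measure_symmetric_convex_body_pos[OF L])
  note lower = measure_complement_lower_bound[OF K, folded r_def n_def V_def]
  \<comment> \<open>The lower bound with \<open>d = 1\<close> gives positive mass, which is required
    for comparing logarithms.\<close>
  have pos: "measure \<mu> (- ((*\<^sub>R) t ` K)) > 0" if "t > 0" for t
    by (rule less_le_trans[OF _ lower[OF that zero_less_one]]) (use \<open>V > 0\<close> in simp)
  show ?thesis
    unfolding r_def[symmetric]
  proof (rule Limsup_ratio_eq_minus_one)
    show "LIM t at_top. \<phi> (r * t) :> at_top"
      by (intro filterlim_compose[OF phi_at_top] filterlim_tendsto_pos_mult_at_top[OF tendsto_const \<open>r > 0\<close>]
          filterlim_ident)
  next
    fix e :: real assume e: "0 < e" "e < 1"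
    obtain C where C: "C > 0" "\<And>A R. A \<in> sets borel \<Longrightarrow> R \<ge> 0 \<Longrightarrow>
        (\<And>x. x \<in> A \<Longrightarrow> R \<le> gauge x) \<Longrightarrow> measure \<mu> A \<le> C * exp (- (1 - e) * \<phi> R)"
      using tail_upper_bound[OF e] by metis
    have "ln (measure \<mu> (- ((*\<^sub>R) t ` K))) \<le> ln C - (1 - e) * \<phi> (r * t)" if "t > 0" for t
    proof -
      have rt: "r * t > 0" using \<open>r > 0\<close> that by simp
      have "compact ((*\<^sub>R) t ` K)"
        using K by (simp add: symmetric_convex_body_def compact_scaling)
      then have "- ((*\<^sub>R) t ` K) \<in> sets borel"
        by (simp add: borel_open compact_imp_closed open_Compl)
      \<comment> \<open>A point of gauge at most \<open>r * t\<close> lies in \<open>r t L\<close>,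
        which is contained in \<open>t K\<close>.\<close>
      moreover have "r * t \<le> gauge x" if "x \<in> - ((*\<^sub>R) t ` K)" for x
      proof (rule ccontr)
        assume "\<not> r * t \<le> gauge x"
        then have "gauge x \<le> r * t" by simp
        then obtain y where y: "y \<in> L" "x = (r * t) *\<^sub>R y"
          using minkowski_functional_le_iff[OF L rt] by auto
        then have "x = t *\<^sub>R (r *\<^sub>R y)" "r *\<^sub>R y \<in> K" using c(2) by (auto simp: mult.commute)
        with that show False by blast
      qed
      ultimately have "measure \<mu> (- ((*\<^sub>R) t ` K)) \<le> C * exp (- (1 - e) * \<phi> (r * t))"
        using rt by (intro C(2)) auto
      then have "ln (measure \<mu> (- ((*\<^sub>R) t ` K))) \<le> ln (C * exp (- (1 - e) * \<phi> (r * t)))"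
        using pos[OF \<open>t > 0\<close>] by simp
      then show ?thesis using C(1) by (simp add: ln_mult algebra_simps)
    qed
    then show "\<exists>C. \<forall>\<^sub>F t in at_top. ln (measure \<mu> (- ((*\<^sub>R) t ` K))) \<le> C - (1 - e) * \<phi> (r * t)"
      by (intro exI[of _ "ln C"] eventually_mono[OF eventually_gt_at_top[of 0]])
  next
    fix e :: real assume e: "0 < e"
    \<comment> \<open>The budget \<open>e\<close> is split into \<open>n + 1\<close> equal shares:
      \<open>n\<close> for the volume factor \<open>d ^ n\<close> and one for the growth of \<phi>
      from \<open>R\<close> to \<open>R + 3 * d\<close>.\<close>
    define e' where "e' = e / (real n + 1)"
    have "e' > 0" using e by (simp add: e'_def add_nonneg_pos)
    have e'_eq: "(real n + 1) * e' = e" by (simp add: e'_def)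
    have "\<exists>t\<ge>T. ln V - (1 + e) * \<phi> (r * t) \<le> ln (measure \<mu> (- ((*\<^sub>R) t ` K)))" for T
    proof -
      \<comment> \<open>With \<open>t = R / r\<close>, the bound \<open>r * T\<close> yields
        \<open>t \<ge> T\<close> and the bound \<open>r\<close> yields \<open>t > 0\<close>.\<close>
      obtain R where R: "R \<ge> max (r * T) r" "\<phi> (R + 3 * exp (- e' * \<phi> R)) \<le> (1 + e') * \<phi> R"
        using mono_unbounded_slow_growth[OF mono phi_at_top \<open>e' > 0\<close>] by blast
      define d where "d = exp (- e' * \<phi> R)"
      define t where "t = R / r"
      have "d > 0" by (simp add: d_def)
      have t: "r * t = R" "t > 0" "t \<ge> T"
        using R(1) \<open>r > 0\<close> by (auto simp: t_def field_simps)
      have "ln (exp (- \<phi> (R + 3 * d)) * (d ^ n * V)) \<le> ln (measure \<mu> (- ((*\<^sub>R) t ` K)))"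
        using lower[OF t(2) \<open>d > 0\<close>] pos[OF t(2)] \<open>d > 0\<close> \<open>V > 0\<close> by (simp add: t(1))
      moreover have "ln (exp (- \<phi> (R + 3 * d)) * (d ^ n * V))
          = - \<phi> (R + 3 * d) - real n * e' * \<phi> R + ln V"
        using \<open>V > 0\<close> by (simp add: d_def ln_mult ln_realpow)
      moreover have "(1 + e) * \<phi> R = (1 + e') * \<phi> R + real n * e' * \<phi> R"
        by (simp add: e'_eq[symmetric] algebra_simps)
      ultimately show ?thesis
        using R(2) t by (intro exI[of _ t]) (simp add: d_def)
    qed
    then show "\<exists>C. \<exists>\<^sub>F t in at_top. C - (1 + e) * \<phi> (r * t) \<le> ln (measure \<mu> (- ((*\<^sub>R) t ` K)))"
      unfolding frequently_def eventually_at_top_linorder by blast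
  qed
qed

end

theorem mainTheorem3:
  fixes K L :: "(real ^ 'n) set"
    and \<phi> :: "real \<Rightarrow> real"
    and \<mu> :: "(real ^ 'n) measure"
  assumes "symmetric_convex_body K"
    and "symmetric_convex_body L"
    and "\<And>s. s \<ge> 0 \<Longrightarrow> \<phi> s \<ge> 0"
    and "convex_on {0..} \<phi>"
    and "mono_on {0..} \<phi>"
    and "prob_space \<mu>"
    and "log_concave_measure \<mu>"
    and "\<mu> = density lborel (\<lambda>x. ennreal (exp (- \<phi> (minkowski_functional L x))))"
  shows "Limsup at_top (\<lambda>t::real.
           ereal (ln (measure \<mu> (- ((*\<^sub>R) t ` K))) / \<phi> (relative_inradius K L * t))) = ereal (- 1)"
proof -
  interpret gauge_density L \<phi> \<mu>
    by (rule gauge_density.intro) fact+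
  show ?thesis by (rule Limsup_ln_measure_complement) fact
qed

end
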